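(* Suppose $\tau\le 1/(4L_f)$ and $f\in C^2$. Let $v_{\mathbf 3}^n,\bar v_{\mathbf 3}^n$ be the BDF2-DC3 solution and its perturbed solution, let $v_{\mathbf 4}^n,\bar v_{\mathbf 4}^n$ be the BDF2-DC3-DC4 solution and its perturbed solution with perturbations $\varepsilon_{\mathbf 4}^n$, and let $\tilde v_{\mathbf 4}^n:=\bar v_{\mathbf 4}^n-v_{\mathbf 4}^n$, so that for $3\le n\le N$ $$\partial_\tau \tilde v_{\mathbf 4}^n=-\vartheta_{n-3}^{(n)}d_1^{(3)}\,\partial_\tau\tilde v_{\mathbf 4}^2+\sum_{i=3}^n\vartheta_{n-i}^{(n)}\Big[f(t_i,\bar v_{\mathbf 4}^i)-f(t_i,v_{\mathbf 4}^i)+\mathcal D_{2,4}f(t_i,v_{\mathbf 3}^i)-\mathcal D_{2,4}f(t_i,\bar v_{\mathbf 3}^i)+\varepsilon_{\mathbf 4}^i\Big].$$ Then for $3\le n\le N$ $$|\tilde v_{\mathbf 4}^{n}|\le 4\exp(4L_ft_{n-1})\Big(|\tilde v_{\mathbf 4}^{2}|+\tau|\partial_\tau\tilde v_{\mathbf 4}^2|+t_n\max_{3\le i\le n}\Big\{|\varepsilon_{\mathbf 4}^i|+\big|\mathcal D_{2,4}f(t_i,v_{\mathbf 3}^i)-\mathcal D_{2,4}f(t_i,\bar v_{\mathbf 3}^i)\big|\Big\}\Big).$$ Thus the BDF2-DC3-DC4 scheme is mesh-robustly stable, i.e. this stability estimate holds with a prefactor independent of the step ratios $r_n$.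
   Context: Problem: $v'(t)=f(t,v)$ for $0<t\le T$, $v(0)=v_0$, where $f$ is Lipschitz-continuous in $v$ with Lipschitz constant $L_f>0$. Mesh: $0=t_0<t_1<\cdots<t_N=T$ is an arbitrary mesh, $\tau_k:=t_k-t_{k-1}$ for $1\le k\le N$, $\tau:=\max_{1\le k\le N}\tau_k$, $r_k:=\tau_k/\tau_{k-1}$ for $k\ge2$. For a sequence $(w^n)$ put $\partial_\tau w^n:=(w^n-w^{n-1})/\tau_n$. BDF2 operator: $D_2w^n:=\sum_{j=1}^n d^{(n)}_{n-j}\partial_\tau w^j$ for $n\ge2$, with $d^{(n)}_0:=\frac{1+2r_n}{1+r_n}$, $d^{(n)}_1:=-\frac{r_n}{1+r_n}$, $d^{(n)}_j:=0$ for $j\ge2$. DOC kernels: $\vartheta_0^{(n)}:=1/d_0^{(n)}$ and $\vartheta_{n-j}^{(n)}:=-\frac1{d_0^{(j)}}\sum_{i=j+1}^n\vartheta_{n-i}^{(n)}d^{(i)}_{i-j}$ for $2\le j\le n-1$. Corrections, with $f[\cdot,\ldots,\cdot]$ the Newton divided differences of the data $f(t_k,w^k)$ at $t_k$: $\mathcal D_{2,3}f(t_n,w^n):=\frac13\big[r_n(\tau_n+\tau_{n-1})^2-(1+r_n)\tau_n^2\big]f[t_n,t_{n-1},t_{n-2}]$ for $n\ge2$ (equivalently $\frac{\tau_n}{3}(\partial_\tau f(t_n,w^n)-\partial_\tau f(t_{n-1},w^{n-1}))$), and $\mathcal D_{2,4}f(t_n,w^n):=\mathcal D_{2,3}f(t_n,w^n)+\frac{\tau_n}{12}(\tau_n+\tau_{n-1})(2\tau_n+\tau_{n-1})f[t_n,t_{n-1},t_{n-2},t_{n-3}]$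 for $n\ge3$. Schemes (starting values given): BDF2: $D_2v_{\mathbf 2}^n=f(t_n,v_{\mathbf 2}^n)$ for $n\ge2$; BDF2-DC3: $D_2v_{\mathbf 3}^n+\mathcal D_{2,3}f(t_n,v_{\mathbf 2}^n)=f(t_n,v_{\mathbf 3}^n)$ for $n\ge2$; BDF2-DC3-DC4: $D_2v_{\mathbf 4}^n+\mathcal D_{2,4}f(t_n,v_{\mathbf 3}^n)=f(t_n,v_{\mathbf 4}^n)$ for $n\ge3$ (starting values at $t_0,t_1,t_2$). Perturbed schemes: $D_2\bar v_{\mathbf 2}^n=f(t_n,\bar v_{\mathbf 2}^n)+\varepsilon_{\mathbf 2}^n$ and $D_2\bar v_{\mathbf 3}^n+\mathcal D_{2,3}f(t_n,\bar v_{\mathbf 2}^n)=f(t_n,\bar v_{\mathbf 3}^n)+\varepsilon_{\mathbf 3}^n$ for $n\ge2$; $D_2\bar v_{\mathbf 4}^n+\mathcal D_{2,4}f(t_n,\bar v_{\mathbf 3}^n)=f(t_n,\bar v_{\mathbf 4}^n)+\varepsilon_{\mathbf 4}^n$ for $n\ge3$; the sequences $\{\varepsilon_{\mathbf 2}^n\},\{\varepsilon_{\mathbf 3}^n\},\{\varepsilon_{\mathbf 4}^n\}$ are bounded. A stability estimate is called mesh-robust if its prefactor (constant) is independent of the step ratios $r_n$. *)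

theory Defs
  imports "HOL-Analysis.Analysis"
begin

text \<open>
  A mesh is a sequence \<open>t :: nat \<Rightarrow> real\<close> of which only the nodes \<open>t 0, \<dots>, t N\<close> matter; likewise
  grid functions \<open>w :: nat \<Rightarrow> real\<close> and perturbations are only constrained at the indices where a
  scheme is imposed. In particular all starting values are arbitrary.
\<close>

definition mesh :: "real \<Rightarrow> nat \<Rightarrow> (nat \<Rightarrow> real) \<Rightarrow> bool" where
  "mesh T N t \<longleftrightarrow> t 0 = 0 \<and> t N = T \<and> (\<forall>k\<in>{1..N}. t (k - 1) < t k)"

definition tau :: "(nat \<Rightarrow> real) \<Rightarrow> nat \<Rightarrow> real" where
  "tau t k = t k - t (k - 1)"

definition max_tau :: "(nat \<Rightarrow> real) \<Rightarrow> nat \<Rightarrow> real" where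
  "max_tau t N = Max (tau t ` {1..N})"

definition ratio :: "(nat \<Rightarrow> real) \<Rightarrow> nat \<Rightarrow> real" where
  "ratio t k = tau t k / tau t (k - 1)"

definition dtau :: "(nat \<Rightarrow> real) \<Rightarrow> (nat \<Rightarrow> real) \<Rightarrow> nat \<Rightarrow> real" where
  "dtau t w n = (w n - w (n - 1)) / tau t n"

text \<open>\<open>bdf2_kernel t n j\<close> is $d^{(n)}_j$, meaningful for \<open>n \<ge> 2\<close>.\<close>

definition bdf2_kernel :: "(nat \<Rightarrow> real) \<Rightarrow> nat \<Rightarrow> nat \<Rightarrow> real" where
  "bdf2_kernel t n j =
     (if j = 0 then (1 + 2 * ratio t n) / (1 + ratio t n)
      else if j = 1 then - (ratio t n / (1 + ratio t n))
      else 0)"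

definition D2 :: "(nat \<Rightarrow> real) \<Rightarrow> (nat \<Rightarrow> real) \<Rightarrow> nat \<Rightarrow> real" where
  "D2 t w n = (\<Sum>j = 1..n. bdf2_kernel t n (n - j) * dtau t w j)"

text \<open>
  \<open>doc_kernel t n k\<close> is $\vartheta^{(n)}_k$, meaningful for \<open>k \<le> n - 2\<close>; the recursion is the usual
  one for $\vartheta^{(n)}_{n-j}$ with \<open>j = n - k\<close>.
\<close>

function doc_kernel :: "(nat \<Rightarrow> real) \<Rightarrow> nat \<Rightarrow> nat \<Rightarrow> real" where
  "doc_kernel t n k =
     (if k = 0 then 1 / bdf2_kernel t n 0
      else - (1 / bdf2_kernel t (n - k) 0) *
        (\<Sum>i = n - k + 1..n. doc_kernel t n (n - i) * bdf2_kernel t i (i - (n - k))))"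
  by pat_completeness auto
termination
  by (relation "Wellfounded.measure (\<lambda>(t, n, k). k)") auto

declare doc_kernel.simps [simp del]

text \<open>
  \<open>divdiff t g n k\<close> is the Newton divided difference $g[t_n, t_{n-1}, \dots, t_{n-k}]$ of the data
  \<open>g i\<close> at the nodes \<open>t i\<close>, meaningful for \<open>k \<le> n\<close>.
\<close>

fun divdiff :: "(nat \<Rightarrow> real) \<Rightarrow> (nat \<Rightarrow> real) \<Rightarrow> nat \<Rightarrow> nat \<Rightarrow> real" where
  "divdiff t g n 0 = g n"
| "divdiff t g n (Suc k) =
     (divdiff t g n k - divdiff t g (n - 1) k) / (t n - t (n - Suc k))"

definition D23 :: "(nat \<Rightarrow> real) \<Rightarrow> (real \<Rightarrow> real \<Rightarrow> real) \<Rightarrow> (nat \<Rightarrow> real) \<Rightarrow> nat \<Rightarrow> real" where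
  "D23 t f w n =
     1 / 3 * (ratio t n * (tau t n + tau t (n - 1))^2 - (1 + ratio t n) * (tau t n)^2)
       * divdiff t (\<lambda>k. f (t k) (w k)) n 2"

definition D24 :: "(nat \<Rightarrow> real) \<Rightarrow> (real \<Rightarrow> real \<Rightarrow> real) \<Rightarrow> (nat \<Rightarrow> real) \<Rightarrow> nat \<Rightarrow> real" where
  "D24 t f w n = D23 t f w n +
     tau t n / 12 * (tau t n + tau t (n - 1)) * (2 * tau t n + tau t (n - 1))
       * divdiff t (\<lambda>k. f (t k) (w k)) n 3"

text \<open>
  Solutions of the schemes with perturbation \<open>e\<close>; the unperturbed schemes are \<open>e = (\<lambda>_. 0)\<close>.
\<close>

definition bdf2_solution ::
  "(real \<Rightarrow> real \<Rightarrow> real) \<Rightarrow> nat \<Rightarrow> (nat \<Rightarrow> real) \<Rightarrow> (nat \<Rightarrow> real) \<Rightarrow> (nat \<Rightarrow> real) \<Rightarrow> bool" where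
  "bdf2_solution f N t e v2 \<longleftrightarrow> (\<forall>n\<in>{2..N}. D2 t v2 n = f (t n) (v2 n) + e n)"

definition dc3_solution ::
  "(real \<Rightarrow> real \<Rightarrow> real) \<Rightarrow> nat \<Rightarrow> (nat \<Rightarrow> real) \<Rightarrow> (nat \<Rightarrow> real) \<Rightarrow> (nat \<Rightarrow> real) \<Rightarrow> (nat \<Rightarrow> real) \<Rightarrow> bool"
  where
  "dc3_solution f N t e v2 v3 \<longleftrightarrow>
     (\<forall>n\<in>{2..N}. D2 t v3 n + D23 t f v2 n = f (t n) (v3 n) + e n)"

definition dc4_solution ::
  "(real \<Rightarrow> real \<Rightarrow> real) \<Rightarrow> nat \<Rightarrow> (nat \<Rightarrow> real) \<Rightarrow> (nat \<Rightarrow> real) \<Rightarrow> (nat \<Rightarrow> real) \<Rightarrow> (nat \<Rightarrow> real) \<Rightarrow> bool"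
  where
  "dc4_solution f N t e v3 v4 \<longleftrightarrow>
     (\<forall>n\<in>{3..N}. D2 t v4 n + D24 t f v3 n = f (t n) (v4 n) + e n)"

definition dc34_run ::
  "(real \<Rightarrow> real \<Rightarrow> real) \<Rightarrow> nat \<Rightarrow> (nat \<Rightarrow> real) \<Rightarrow> (nat \<Rightarrow> real) \<Rightarrow> (nat \<Rightarrow> real) \<Rightarrow> (nat \<Rightarrow> real) \<Rightarrow>
   (nat \<Rightarrow> real) \<Rightarrow> (nat \<Rightarrow> real) \<Rightarrow> (nat \<Rightarrow> real) \<Rightarrow> bool" where
  "dc34_run f N t e2 e3 e4 v2 v3 v4 \<longleftrightarrow>
     bounded (e2 ` {2..N}) \<and> bounded (e3 ` {2..N}) \<and> bounded (e4 ` {3..N}) \<and>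
     bdf2_solution f N t e2 v2 \<and> dc3_solution f N t e3 v2 v3 \<and> dc4_solution f N t e4 v3 v4"

text \<open>
  Twice continuously differentiable on a set. Derivatives are taken relative to the set, hence
  one-sided on the boundary, so that the closed strip \<open>{0..T} \<times> UNIV\<close> is allowed.
\<close>

definition C2_on :: "('a::real_normed_vector \<Rightarrow> 'b::real_normed_vector) \<Rightarrow> 'a set \<Rightarrow> bool" where
  "C2_on g S \<longleftrightarrow>
     (\<exists>(g' :: 'a \<Rightarrow> 'a \<Rightarrow>\<^sub>L 'b) (g'' :: 'a \<Rightarrow> 'a \<Rightarrow>\<^sub>L 'a \<Rightarrow>\<^sub>L 'b).
        (\<forall>p\<in>S. (g has_derivative blinfun_apply (g' p)) (at p within S) \<and>
               (g' has_derivative blinfun_apply (g'' p)) (at p within S)) \<and>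
        continuous_on S g'')"

text \<open>
  Mesh-robust stability on \<open>{0..T}\<close> for maximal steps up to \<open>h\<close>: the prefactor \<open>C\<close> is chosen before
  the mesh, so it cannot depend on the step ratios.
\<close>

definition dc34_mesh_robustly_stable :: "real \<Rightarrow> (real \<Rightarrow> real \<Rightarrow> real) \<Rightarrow> real \<Rightarrow> bool" where
  "dc34_mesh_robustly_stable T f h \<longleftrightarrow>
     (\<exists>C. \<forall>N t e2 e3 e4 v2 v3 v4 vb2 vb3 vb4 w.
        mesh T N t \<and> max_tau t N \<le> h \<and>
        dc34_run f N t (\<lambda>_. 0) (\<lambda>_. 0) (\<lambda>_. 0) v2 v3 v4 \<and>
        dc34_run f N t e2 e3 e4 vb2 vb3 vb4 \<and>
        w = (\<lambda>n. vb4 n - v4 n) \<longrightarrow>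
        (\<forall>n\<in>{3..N}.
           \<bar>w n\<bar> \<le> C * (\<bar>w 2\<bar> + max_tau t N * \<bar>dtau t w 2\<bar>
                      + t n * Max ((\<lambda>i. \<bar>e4 i\<bar> + \<bar>D24 t f v3 i - D24 t f vb3 i\<bar>) ` {3..n}))))"

end

theory Submission
  imports Defs
begin

text \<open>
  Writing $a_n = r_n/(1+2r_n)$, the BDF2 relation $D_2 w^n = g^n$ is the first-order recursion
  $\partial_\tau w^n = a_n\,\partial_\tau w^{n-1} + (1-a_n)\,g^n$ with $0 < a_n < 1/2$, whatever the
  step ratios are. Hence $|\partial_\tau w^n|$ is at most $2^{-(n-2)}|\partial_\tau w^2|$ plus the
  largest $|g^i|$. Multiplying by $\tau_n$ and summing, the geometric series costs only
  $\tau|\partial_\tau w^2|$, and since $L_f\tau\le 1/4$ the Lipschitz part of $g$ is absorbed by a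
  discrete Gronwall argument for the running maximum of $|w^i|$.
\<close>

subsection \<open>Meshes\<close>

lemma mesh_mono:
  assumes "mesh T N t" "i \<le> j" "j \<le> N"
  shows "t i \<le> t j"
  using assms(2,3)
proof (induction j rule: dec_induct)
  case (step k)
  then show ?case
    using assms(1) unfolding mesh_def by (force dest: bspec[of _ _ "Suc k"])
qed simp

lemma mesh_tau_pos:
  assumes "mesh T N t" "1 \<le> k" "k \<le> N"
  shows "tau t k > 0"
  using assms by (auto simp: mesh_def tau_def)

lemma mesh_ratio_pos:
  assumes "mesh T N t" "2 \<le> k" "k \<le> N"
  shows "ratio t k > 0"
  using assms by (auto simp: ratio_def intro!: divide_pos_pos mesh_tau_pos)

lemma tau_le_max_tau:
  assumes "1 \<le> k" "k \<le> N"
  shows "tau t k \<le> max_tau t N"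
  using assms by (auto simp: max_tau_def intro!: Max_ge)

subsection \<open>The BDF2 operator and its DOC kernels\<close>

lemma bdf2_kernel_0_pos: "ratio t n > 0 \<Longrightarrow> bdf2_kernel t n 0 > 0"
  by (simp add: bdf2_kernel_def)

lemma D2_two_terms:
  assumes "2 \<le> n"
  shows "D2 t w n = bdf2_kernel t n 0 * dtau t w n + bdf2_kernel t n 1 * dtau t w (n - 1)"
proof -
  have "D2 t w n = (\<Sum>j\<in>{n - 1, n}. bdf2_kernel t n (n - j) * dtau t w j)"
    unfolding D2_def
    by (rule sum.mono_neutral_right) (use assms in \<open>auto simp: bdf2_kernel_def\<close>)
  with assms show ?thesis
    by simp
qed

lemma D2_diff: "D2 t (\<lambda>n. v n - w n) n = D2 t v n - D2 t w n"
  by (simp add: D2_def dtau_def sum_subtractf[symmetric] diff_divide_distrib add_divide_distrib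
      algebra_simps)

text \<open>Since \<open>bdf2_kernel\<close> vanishes beyond offset 1, only the summand
  \<open>i = n - k\<close> of the recursion survives, so the DOC kernels obey a two-term
  recursion.\<close>

lemma doc_kernel_Suc:
  assumes "k < n"
  shows "doc_kernel t n (Suc k) =
    - (doc_kernel t n k * bdf2_kernel t (n - k) 1 / bdf2_kernel t (n - Suc k) 0)"
proof -
  have "(\<Sum>i = n - Suc k + 1..n. doc_kernel t n (n - i) * bdf2_kernel t i (i - (n - Suc k))) =
        (\<Sum>i\<in>{n - k}. doc_kernel t n (n - i) * bdf2_kernel t i (i - (n - Suc k)))"
    by (rule sum.mono_neutral_right) (use assms in \<open>auto simp: bdf2_kernel_def\<close>)
  with assms show ?thesis
    by (subst doc_kernel.simps) simp
qed

text \<open>The definition recurses over \<open>k\<close> in a fixed row \<open>n\<close>, whereas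
  time stepping moves from row \<open>n\<close> to row \<open>Suc n\<close> with
  \<open>n - k\<close> fixed. That move multiplies every entry by one common factor, which permits
  induction over \<open>n\<close>.\<close>

lemma doc_kernel_shift:
  assumes "k \<le> n"
  shows "doc_kernel t (Suc n) (Suc k) =
    - (bdf2_kernel t (Suc n) 1 / bdf2_kernel t (Suc n) 0) * doc_kernel t n k"
  using assms
proof (induction k)
  case 0
  then show ?case
    by (simp add: doc_kernel_Suc doc_kernel.simps[of _ _ 0])
next
  case (Suc k)
  then show ?case
    by (subst doc_kernel_Suc) (auto simp: doc_kernel_Suc)
qed

text \<open>Solving the relation at \<open>Suc n\<close> for \<open>u (Suc n)\<close> gives a
  multiple of \<open>u n\<close> plus the new datum. By \<open>doc_kernel_shift\<close> this
  multiple turns the representation at \<open>n\<close> into all but the last term of the one at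
  \<open>Suc n\<close>.\<close>

lemma doc_kernel_representation:
  assumes "1 \<le> m" "m \<le> n"
    and "\<And>i. i \<in> {m..n} \<Longrightarrow> bdf2_kernel t i 0 \<noteq> 0"
    and "\<And>i. i \<in> {m..n} \<Longrightarrow> bdf2_kernel t i 0 * u i + bdf2_kernel t i 1 * u (i - 1) = g i"
  shows "u n = - doc_kernel t n (n - m) * bdf2_kernel t m 1 * u (m - 1)
    + (\<Sum>i = m..n. doc_kernel t n (n - i) * g i)"
  using assms(2-4)
proof (induction n rule: dec_induct)
  case base
  then show ?case
    by (simp add: doc_kernel.simps[of _ _ 0] field_simps)
next
  case (step n)
  define a where "a = - (bdf2_kernel t (Suc n) 1 / bdf2_kernel t (Suc n) 0)"
  have shift: "doc_kernel t (Suc n) (Suc n - i) = a * doc_kernel t n (n - i)" if "i \<le> n" for i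
    using that by (simp add: Suc_diff_le doc_kernel_shift a_def)
  have nz: "bdf2_kernel t (Suc n) 0 \<noteq> 0"
    and eq: "bdf2_kernel t (Suc n) 0 * u (Suc n) + bdf2_kernel t (Suc n) 1 * u n = g (Suc n)"
    using step.prems(1)[of "Suc n"] step.prems(2)[of "Suc n"] step.hyps by auto
  have "u (Suc n) = a * u n + doc_kernel t (Suc n) 0 * g (Suc n)"
    using nz by (simp add: eq[symmetric] a_def doc_kernel.simps[of _ _ 0] field_simps)
  also have "u n = - doc_kernel t n (n - m) * bdf2_kernel t m 1 * u (m - 1)
    + (\<Sum>i = m..n. doc_kernel t n (n - i) * g i)"
    using step by auto
  also have "a * \<dots> = - doc_kernel t (Suc n) (Suc n - m) * bdf2_kernel t m 1 * u (m - 1)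
    + (\<Sum>i = m..n. doc_kernel t (Suc n) (Suc n - i) * g i)"
    using step.hyps by (simp add: shift algebra_simps sum_distrib_left)
  finally show ?case
    using step.hyps by simp
qed

subsection \<open>Stability of the BDF2 operator\<close>

text \<open>Here \<open>x\<close> is a convex combination of \<open>y\<close> and \<open>g\<close>
  whose weight on \<open>y\<close> is at most 1/2. The common part \<open>G\<close> of both bounds
  is therefore reproduced and only the excess \<open>p\<close> is halved.\<close>

lemma bdf2_recursion_abs_le:
  assumes "ratio t n > 0"
    and "bdf2_kernel t n 0 * x + bdf2_kernel t n 1 * y = g"
    and "\<bar>y\<bar> \<le> p + G" "\<bar>g\<bar> \<le> G" "0 \<le> p"
  shows "\<bar>x\<bar> \<le> p / 2 + G"
proof -
  \<comment> \<open>This is the quotient -d_1/d_0 of the kernels; the coefficient 1/d_0 of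
    \<open>g\<close> is then 1 - a.\<close>
  define a where "a = ratio t n / (1 + 2 * ratio t n)"
  have a: "0 \<le> a" "a \<le> 1 / 2"
    using assms(1) by (auto simp: a_def field_simps)
  have "x = a * y + (1 - a) * g"
    using assms(1)
    by (simp add: assms(2)[symmetric] a_def bdf2_kernel_def divide_simps) (simp add: algebra_simps)
  then have "\<bar>x\<bar> \<le> a * \<bar>y\<bar> + (1 - a) * \<bar>g\<bar>"
    using a abs_triangle_ineq[of "a * y" "(1 - a) * g"] by (simp add: abs_mult)
  also have "\<dots> \<le> a * (p + G) + (1 - a) * G"
    using a assms(3,4) by (intro add_mono mult_left_mono) auto
  also have "\<dots> \<le> p / 2 + G"
    using a mult_right_mono[OF a(2) assms(5)] by (simp add: algebra_simps)
  finally show ?thesis .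
qed

lemma half_power_Suc_diff:
  assumes "2 \<le> n"
  shows "(1 / 2 :: real) ^ (Suc n - 2) = (1 / 2) ^ (n - 2) / 2"
  using assms by (auto simp: le_iff_add)

text \<open>Iterates the halving of the excess. Monotonicity of \<open>G\<close> lets
  \<open>G n\<close> be replaced by \<open>G (Suc n)\<close> before each step, so that both bounds
  share the same \<open>G\<close>.\<close>

lemma dtau_abs_le:
  assumes "mesh T N t" "2 \<le> n" "n \<le> N"
    and "\<And>i. i \<in> {3..N} \<Longrightarrow> \<bar>D2 t w i\<bar> \<le> G i"
    and "\<And>i j. 2 \<le> i \<Longrightarrow> i \<le> j \<Longrightarrow> j \<le> N \<Longrightarrow> G i \<le> G j"
    and "0 \<le> G 2"
  shows "\<bar>dtau t w n\<bar> \<le> (1 / 2) ^ (n - 2) * \<bar>dtau t w 2\<bar> + G n"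
  using assms(2,3)
proof (induction n rule: dec_induct)
  case base
  then show ?case
    using assms(6) by simp
next
  case (step n)
  have "\<bar>dtau t w (Suc n)\<bar> \<le> (1 / 2) ^ (n - 2) * \<bar>dtau t w 2\<bar> / 2 + G (Suc n)"
  proof (rule bdf2_recursion_abs_le)
    show "ratio t (Suc n) > 0"
      using step assms(1) by (intro mesh_ratio_pos) auto
    show "bdf2_kernel t (Suc n) 0 * dtau t w (Suc n) + bdf2_kernel t (Suc n) 1 * dtau t w n
      = D2 t w (Suc n)"
      using step by (simp add: D2_two_terms)
    show "\<bar>D2 t w (Suc n)\<bar> \<le> G (Suc n)"
      using step by (intro assms(4)) auto
    have "G n \<le> G (Suc n)"
      using step by (intro assms(5)) auto
    with step show "\<bar>dtau t w n\<bar> \<le> (1 / 2) ^ (n - 2) * \<bar>dtau t w 2\<bar> + G (Suc n)"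
      by auto
  qed simp
  then show ?case
    unfolding half_power_Suc_diff[OF step.hyps(1)] by simp
qed

lemma grid_abs_le:
  assumes "mesh T N t" "2 \<le> n" "n \<le> N" "0 \<le> c"
    and "\<And>i. i \<in> {3..N} \<Longrightarrow> \<bar>dtau t w i\<bar> \<le> (1 / 2) ^ (i - 2) * c + G i"
  shows "\<bar>w n\<bar> \<le> \<bar>w 2\<bar> + max_tau t N * c + (\<Sum>i = 3..n. tau t i * G i)"
proof -
  \<comment> \<open>The partial sum of the geometric series is kept exactly so that the induction
    closes; it is bounded by 1 only afterwards.\<close>
  have "\<bar>w n\<bar> \<le> \<bar>w 2\<bar> + max_tau t N * c * (1 - (1 / 2) ^ (n - 2)) + (\<Sum>i = 3..n. tau t i * G i)"
    using assms(2,3)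
  proof (induction n rule: dec_induct)
    case (step n)
    have tau: "0 < tau t (Suc n)" "tau t (Suc n) \<le> max_tau t N"
      using step assms(1) by (auto intro!: mesh_tau_pos tau_le_max_tau)
    have "w (Suc n) = w n + tau t (Suc n) * dtau t w (Suc n)"
      using tau by (simp add: dtau_def)
    then have "\<bar>w (Suc n)\<bar> \<le> \<bar>w n\<bar> + tau t (Suc n) * \<bar>dtau t w (Suc n)\<bar>"
      using tau abs_triangle_ineq[of "w n" "tau t (Suc n) * dtau t w (Suc n)"]
      by (simp add: abs_mult)
    also have "\<dots> \<le> \<bar>w n\<bar> + tau t (Suc n) * ((1 / 2) ^ (Suc n - 2) * c + G (Suc n))"
      using tau step by (intro add_left_mono mult_left_mono assms(5)) auto
    also have "\<dots> \<le> \<bar>w n\<bar> + (max_tau t N * ((1 / 2) ^ (Suc n - 2) * c) + tau t (Suc n) * G (Suc n))"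
      using tau assms(4) by (simp add: distrib_left mult_right_mono)
    finally show ?case
      using step.IH step.prems step.hyps(1)
      unfolding half_power_Suc_diff[OF step.hyps(1)]
      by (simp add: right_diff_distrib mult_ac)
  qed simp
  moreover have "max_tau t N * c * (1 - (1 / 2) ^ (n - 2)) \<le> max_tau t N * c"
  proof (rule mult_right_le_one_le)
    have "0 < max_tau t N"
      using mesh_tau_pos[OF assms(1), of 1] tau_le_max_tau[of 1 N t] assms(2,3) by simp
    then show "0 \<le> max_tau t N * c"
      using assms(4) by simp
  qed (auto simp: power_le_one)
  ultimately show ?thesis
    by linarith
qed

section \<open>Discrete Gronwall inequality\<close>

text \<open>Uses (1 - x)(1 + 2x) = 1 + x(1 - 2x).\<close>

lemma inverse_one_minus_le_exp:
  fixes x :: real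
  assumes "0 \<le> x" "x \<le> 1 / 2"
  shows "1 \<le> (1 - x) * exp (2 * x)"
proof -
  have "1 \<le> (1 - x) * (1 + 2 * x)"
    using mult_left_mono[OF assms(2,1)] by (simp add: algebra_simps)
  also have "\<dots> \<le> (1 - x) * exp (2 * x)"
    using assms by (intro mult_left_mono exp_ge_add_one_self) auto
  finally show ?thesis .
qed

text \<open>The sum includes the index \<open>k\<close> itself, so the inequality is implicit in
  \<open>M k\<close>; the step restriction makes it solvable. The right-hand side is estimated
  instead of \<open>M\<close>: it grows per step by at most 1/(1 - x) with x =
  \<open>L * tau t k\<close>, and the exponents 2x telescope.\<close>

lemma discrete_gronwall:
  assumes "mesh T N t" "m \<le> n" "n \<le> N" "0 \<le> L" "0 \<le> A"
    and "\<And>k. k \<in> {m<..N} \<Longrightarrow> L * tau t k \<le> 1 / 2"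
    and "\<And>k. k \<in> {m..N} \<Longrightarrow> M k \<le> A + L * (\<Sum>i = Suc m..k. tau t i * M i)"
  shows "A + L * (\<Sum>i = Suc m..n. tau t i * M i) \<le> A * exp (2 * L * (t n - t m))"
  using assms(2,3)
proof (induction n rule: dec_induct)
  case (step n)
  let ?V = "\<lambda>n. A + L * (\<Sum>i = Suc m..n. tau t i * M i)"
  define x where "x = L * tau t (Suc n)"
  have x: "0 \<le> x" "x \<le> 1 / 2"
    using step assms(6)[of "Suc n"] mesh_tau_pos[OF assms(1), of "Suc n"] assms(4)
    by (auto simp: x_def)
  have "?V (Suc n) = ?V n + x * M (Suc n)"
    using step.hyps by (simp add: x_def algebra_simps)
  also have "\<dots> \<le> ?V n + x * ?V (Suc n)"
    using x step by (intro add_left_mono mult_left_mono assms(7)) auto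
  finally have "(1 - x) * ?V (Suc n) \<le> ?V n"
    by (simp add: algebra_simps)
  also have "\<dots> \<le> A * exp (2 * L * (t n - t m))"
    using step by simp
  \<comment> \<open>Inserting a factor that is at least 1 creates the 1 - x that is cancelled at the
    end.\<close>
  also have "\<dots> \<le> A * exp (2 * L * (t n - t m)) * ((1 - x) * exp (2 * x))"
    using inverse_one_minus_le_exp[OF x] assms(5)
      mult_left_mono[of 1 _ "A * exp (2 * L * (t n - t m))"]
    by simp
  also have "\<dots> = (1 - x) * (A * exp (2 * L * (t (Suc n) - t m)))"
    by (simp add: x_def tau_def exp_add[symmetric] algebra_simps)
  finally show ?case
    using x by simp
qed simp

section \<open>Stability estimate from a bound on the BDF2 operator\<close>

text \<open>The scheme enters only through a bound on \<open>D2 t w\<close>; corrections and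
  perturbations are collected in \<open>E\<close>.\<close>

lemma bdf2_stability:
  assumes mesh: "mesh T N t" and "0 \<le> L" and step: "L * max_tau t N \<le> 1 / 4"
    and n: "n \<in> {3..N}"
    and E_nonneg: "\<And>i. i \<in> {3..n} \<Longrightarrow> 0 \<le> E i"
    and D2_le: "\<And>i. i \<in> {3..n} \<Longrightarrow> \<bar>D2 t w i\<bar> \<le> L * \<bar>w i\<bar> + E i"
  shows "\<bar>w n\<bar> \<le> 4 * exp (4 * L * t (n - 1)) *
    (\<bar>w 2\<bar> + max_tau t N * \<bar>dtau t w 2\<bar> + t n * Max (E ` {3..n}))"
proof -
  define E0 where "E0 = Max (E ` {3..n})"
  \<comment> \<open>Replacing \<bar>w i\<bar> by the running maximum gives the nondecreasing bound
    \<open>L * M i + E0\<close> that \<open>dtau_abs_le\<close> asks for.\<close>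
  define M where "M k = Max ((\<lambda>i. \<bar>w i\<bar>) ` {2..k})" for k
  define A where "A = \<bar>w 2\<bar> + max_tau t N * \<bar>dtau t w 2\<bar> + t n * E0"
  let ?V = "\<lambda>k. A + L * (\<Sum>i = 3..k. tau t i * M i)"
  \<comment> \<open>Restricting the mesh to the first \<open>n\<close> steps keeps \<open>E0\<close> a bound on all perturbations in play.\<close>
  have mesh_n: "mesh (t n) n t"
    using mesh n by (auto simp: mesh_def)
  have max_tau_mono: "max_tau t n \<le> max_tau t N"
    using n unfolding max_tau_def by (intro Max_mono) auto
  have tau_le: "L * tau t k \<le> 1 / 4" if "1 \<le> k" "k \<le> N" for k
    using tau_le_max_tau[OF that, of t] \<open>0 \<le> L\<close> step by (meson mult_left_mono order_trans)
  have t_nonneg: "0 \<le> t k" if "k \<le> N" for k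
    using mesh_mono[OF mesh, of 0 k] that mesh by (simp add: mesh_def)
  have E_le: "E i \<le> E0" if "i \<in> {3..n}" for i
    using that unfolding E0_def by (intro Max_ge) auto
  have E0: "0 \<le> E0"
    using E_le[of 3] E_nonneg[of 3] n by force
  have max_tau: "0 \<le> max_tau t N"
    using mesh_tau_pos[OF mesh, of 1] tau_le_max_tau[of 1 N t] n by simp
  have A: "0 \<le> A"
    using max_tau E0 t_nonneg[of n] n by (simp add: A_def)
  have w_le_M: "\<bar>w i\<bar> \<le> M k" if "2 \<le> i" "i \<le> k" for i k
    using that unfolding M_def by (intro Max_ge) auto
  have M_nonneg: "0 \<le> M k" if "2 \<le> k" for k
    using w_le_M[of 2 k] that by force
  have M_mono: "M i \<le> M j" if "2 \<le> i" "i \<le> j" for i j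
    using that unfolding M_def by (intro Max_mono) auto
  have D2_le': "\<bar>D2 t w i\<bar> \<le> L * M i + E0" if "i \<in> {3..n}" for i
    using D2_le[OF that] E_le[OF that] mult_left_mono[OF w_le_M[of i i] \<open>0 \<le> L\<close>] that by auto
  have dtau_le: "\<bar>dtau t w i\<bar> \<le> (1 / 2) ^ (i - 2) * \<bar>dtau t w 2\<bar> + (L * M i + E0)"
    if "i \<in> {3..n}" for i
    using that mesh_n D2_le' E0 M_nonneg[of 2] \<open>0 \<le> L\<close> M_mono
    by (intro dtau_abs_le[where N = n]) (auto intro: mult_left_mono)
  have V_mono: "?V i \<le> ?V j" if "i \<le> j" "j \<le> n" for i j
    using that n \<open>0 \<le> L\<close>
    by (intro add_left_mono mult_left_mono sum_mono2)
      (auto intro!: mult_nonneg_nonneg M_nonneg less_imp_le[OF mesh_tau_pos[OF mesh]])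
  have w_le_V: "\<bar>w k\<bar> \<le> ?V k" if "2 \<le> k" "k \<le> n" for k
  proof -
    \<comment> \<open>The steps telescope, so the constant part \<open>E0\<close> contributes at
      most \<open>t n * E0\<close>, the last term of \<open>A\<close>.\<close>
    have "(\<Sum>i = 3..k. tau t i) = t k - t 2"
      using sum_telescope''[of 2 k t] that by (simp add: tau_def numeral_3_eq_3 numeral_2_eq_2
        atLeastSucAtMost_greaterThanAtMost)
    then have "(\<Sum>i = 3..k. tau t i) \<le> t n"
      using mesh_mono[OF mesh_n, of k n] t_nonneg[of 2] that n by auto
    then have "(\<Sum>i = 3..k. tau t i) * E0 \<le> t n * E0"
      using E0 by (rule mult_right_mono)
    moreover have "\<bar>w k\<bar> \<le> \<bar>w 2\<bar> + max_tau t n * \<bar>dtau t w 2\<bar>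
      + (\<Sum>i = 3..k. tau t i * (L * M i + E0))"
      using dtau_le that by (intro grid_abs_le[OF mesh_n]) auto
    moreover have "max_tau t n * \<bar>dtau t w 2\<bar> \<le> max_tau t N * \<bar>dtau t w 2\<bar>"
      using max_tau_mono by (intro mult_right_mono) auto
    moreover have "(\<Sum>i = 3..k. tau t i * (L * M i + E0)) =
      L * (\<Sum>i = 3..k. tau t i * M i) + (\<Sum>i = 3..k. tau t i) * E0"
      by (simp add: distrib_left sum.distrib sum_distrib_left sum_distrib_right mult.left_commute)
    ultimately show ?thesis
      unfolding A_def by linarith
  qed
  have M_le_V: "M k \<le> ?V k" if "2 \<le> k" "k \<le> n" for k
  proof -
    \<comment> \<open>As \<open>?V\<close> is nondecreasing, the pointwise bounds pass to the
      running maximum.\<close>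
    have "\<bar>w i\<bar> \<le> ?V k" if "i \<in> {2..k}" for i
      using w_le_V[of i] V_mono[of i k] that \<open>k \<le> n\<close> by auto
    then show ?thesis
      using that unfolding M_def[of k] by (intro Max.boundedI) auto
  qed
  \<comment> \<open>Gronwall stops at \<open>n - 1\<close>, which puts \<open>t (n - 1)\<close>
    rather than \<open>t n\<close> into the exponent; the last step is absorbed separately.\<close>
  have "?V (n - 1) \<le> A * exp (2 * L * (t (n - 1) - t 2))"
  proof -
    have "A + L * (\<Sum>i = Suc 2..n - 1. tau t i * M i) \<le> A * exp (2 * L * (t (n - 1) - t 2))"
    proof (rule discrete_gronwall[OF mesh_n])
      show "L * tau t k \<le> 1 / 2" if "k \<in> {2<..n}" for k
        using tau_le[of k] that n by simp
      show "M k \<le> A + L * (\<Sum>i = Suc 2..k. tau t i * M i)" if "k \<in> {2..n}" for k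
        using M_le_V[of k] that by simp
    qed (use n \<open>0 \<le> L\<close> A in auto)
    then show ?thesis
      by simp
  qed
  also have "\<dots> \<le> A * exp (4 * L * t (n - 1))"
  proof -
    have "2 * L * (t (n - 1) - t 2) \<le> 4 * L * t (n - 1)"
      using t_nonneg[of 2] mesh_mono[OF mesh_n, of 2 "n - 1"] n \<open>0 \<le> L\<close>
      by (intro mult_mono) auto
    then show ?thesis
      using A by (intro mult_left_mono) auto
  qed
  finally have prev: "?V (n - 1) \<le> A * exp (4 * L * t (n - 1))" .
  have "?V n = ?V (n - 1) + L * tau t n * M n"
  proof -
    have "{3..n} = insert n {3..n - 1}" "n \<notin> {3..n - 1}"
      using n by auto
    then show ?thesis
      by (simp add: algebra_simps)
  qed
  moreover have "L * tau t n * M n \<le> 1 / 4 * M n"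
    using tau_le[of n] M_nonneg[of n] n by (intro mult_right_mono) auto
  \<comment> \<open>A quarter of \<open>M n\<close> moves to the left-hand side; the resulting
    factor 4/3 is rounded up to 4.\<close>
  ultimately have "M n \<le> 4 * (A * exp (4 * L * t (n - 1)))"
    using prev M_le_V[of n] M_nonneg[of n] n by simp
  then show ?thesis
    using w_le_M[of n n] n by (simp add: A_def E0_def algebra_simps)
qed

section \<open>Error equation and stability of the BDF2-DC3-DC4 scheme\<close>

lemma dc4_solution_D2_diff:
  assumes "dc4_solution f N t (\<lambda>_. 0) v3 v4" "dc4_solution f N t e vb3 vb4" "n \<in> {3..N}"
  shows "D2 t (\<lambda>n. vb4 n - v4 n) n =
    f (t n) (vb4 n) - f (t n) (v4 n) + D24 t f v3 n - D24 t f vb3 n + e n"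
proof -
  have "D2 t v4 n + D24 t f v3 n = f (t n) (v4 n)"
    and "D2 t vb4 n + D24 t f vb3 n = f (t n) (vb4 n) + e n"
    using assms by (auto simp: dc4_solution_def)
  then show ?thesis
    by (simp add: D2_diff)
qed

lemma dc4_representation_and_stability:
  assumes "0 < L" and lip: "\<forall>s\<in>{0..T}. L-lipschitz_on UNIV (f s)"
    and mesh: "mesh T N t" and step: "max_tau t N \<le> 1 / (4 * L)"
    and sol: "dc4_solution f N t (\<lambda>_. 0) v3 v4" "dc4_solution f N t e vb3 vb4"
    and w: "w = (\<lambda>n. vb4 n - v4 n)"
    and n: "n \<in> {3..N}"
  shows "dtau t w n = - doc_kernel t n (n - 3) * bdf2_kernel t 3 1 * dtau t w 2
      + (\<Sum>i = 3..n. doc_kernel t n (n - i) *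
          (f (t i) (vb4 i) - f (t i) (v4 i) + D24 t f v3 i - D24 t f vb3 i + e i))" (is ?repr)
    and "\<bar>w n\<bar> \<le> 4 * exp (4 * L * t (n - 1)) *
      (\<bar>w 2\<bar> + max_tau t N * \<bar>dtau t w 2\<bar>
       + t n * Max ((\<lambda>i. \<bar>e i\<bar> + \<bar>D24 t f v3 i - D24 t f vb3 i\<bar>) ` {3..n}))" (is ?bound)
proof -
  have D2_w: "D2 t w i = f (t i) (vb4 i) - f (t i) (v4 i) + D24 t f v3 i - D24 t f vb3 i + e i"
    if "i \<in> {3..N}" for i
    unfolding w using sol that by (rule dc4_solution_D2_diff)
  show ?repr
  proof -
    have "bdf2_kernel t i 0 \<noteq> 0" if "i \<in> {3..n}" for i
      using bdf2_kernel_0_pos[OF mesh_ratio_pos[OF mesh, of i]] that n by auto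
    moreover have "bdf2_kernel t i 0 * dtau t w i + bdf2_kernel t i 1 * dtau t w (i - 1) =
        f (t i) (vb4 i) - f (t i) (v4 i) + D24 t f v3 i - D24 t f vb3 i + e i"
      if "i \<in> {3..n}" for i
      using D2_w[of i] D2_two_terms[of i t w] that n by auto
    ultimately show ?thesis
      \<comment> \<open>The scheme starts at index 3, so the boundary term carries the difference
        quotient at index 2.\<close>
      using doc_kernel_representation[of 3 n t "dtau t w"] n by simp
  qed
  show ?bound
  proof (rule bdf2_stability[OF mesh _ _ n])
    show "L * max_tau t N \<le> 1 / 4"
      using step \<open>0 < L\<close> by (simp add: field_simps)
    fix i assume i: "i \<in> {3..n}"
    \<comment> \<open>The Lipschitz bound is assumed only for times in this interval.\<close>
    have "t i \<in> {0..T}"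
      using mesh_mono[OF mesh, of 0 i] mesh_mono[OF mesh, of i N] mesh i n
      by (auto simp: mesh_def)
    then have "\<bar>f (t i) (vb4 i) - f (t i) (v4 i)\<bar> \<le> L * \<bar>w i\<bar>"
      using lip lipschitz_onD[of L UNIV "f (t i)" "vb4 i" "v4 i"] by (simp add: dist_real_def w)
    then show "\<bar>D2 t w i\<bar> \<le> L * \<bar>w i\<bar> + (\<bar>e i\<bar> + \<bar>D24 t f v3 i - D24 t f vb3 i\<bar>)"
      using D2_w[of i] i n by auto
  qed (use \<open>0 < L\<close> in auto)
qed

theorem theorem3p1:
  fixes f :: "real \<Rightarrow> real \<Rightarrow> real" and T L :: real
  assumes "T > 0" and "L > 0"
    and "\<forall>s\<in>{0..T}. L-lipschitz_on UNIV (f s)"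
    and "C2_on (\<lambda>(s, v). f s v) ({0..T} \<times> UNIV)"
  shows "(\<forall>N t e2 e3 e4 v2 v3 v4 vb2 vb3 vb4 w.
        mesh T N t \<and> max_tau t N \<le> 1 / (4 * L) \<and>
        dc34_run f N t (\<lambda>_. 0) (\<lambda>_. 0) (\<lambda>_. 0) v2 v3 v4 \<and>
        dc34_run f N t e2 e3 e4 vb2 vb3 vb4 \<and>
        w = (\<lambda>n. vb4 n - v4 n) \<longrightarrow>
        (\<forall>n\<in>{3..N}.
           dtau t w n = - doc_kernel t n (n - 3) * bdf2_kernel t 3 1 * dtau t w 2
             + (\<Sum>i = 3..n. doc_kernel t n (n - i) *
                  (f (t i) (vb4 i) - f (t i) (v4 i) + D24 t f v3 i - D24 t f vb3 i + e4 i)) \<and>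
           \<bar>w n\<bar> \<le> 4 * exp (4 * L * t (n - 1)) *
             (\<bar>w 2\<bar> + max_tau t N * \<bar>dtau t w 2\<bar>
              + t n * Max ((\<lambda>i. \<bar>e4 i\<bar> + \<bar>D24 t f v3 i - D24 t f vb3 i\<bar>) ` {3..n})))) \<and>
    dc34_mesh_robustly_stable T f (1 / (4 * L))"
proof (rule conjI)
  show "dc34_mesh_robustly_stable T f (1 / (4 * L))"
    unfolding dc34_mesh_robustly_stable_def
  \<comment> \<open>Bounding \<open>t (n - 1)\<close> by \<open>T\<close> leaves a prefactor that
    depends on \<open>L\<close> and \<open>T\<close> alone, hence can be fixed before the
    mesh.\<close>
  proof (rule exI[of _ "4 * exp (4 * L * T)"], intro allI impI ballI, elim conjE)
    fix N t n e2 e3 e4 v2 v3 v4 vb2 vb3 vb4 and w :: "nat \<Rightarrow> real"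
    assume mesh: "mesh T N t" and step: "max_tau t N \<le> 1 / (4 * L)"
      and run: "dc34_run f N t (\<lambda>_. 0) (\<lambda>_. 0) (\<lambda>_. 0) v2 v3 v4"
        "dc34_run f N t e2 e3 e4 vb2 vb3 vb4"
      and w: "w = (\<lambda>n. vb4 n - v4 n)" and n: "n \<in> {3..N}"
    let ?E = "\<lambda>i. \<bar>e4 i\<bar> + \<bar>D24 t f v3 i - D24 t f vb3 i\<bar>"
    let ?R = "\<bar>w 2\<bar> + max_tau t N * \<bar>dtau t w 2\<bar> + t n * Max (?E ` {3..n})"
    have "\<bar>w n\<bar> \<le> 4 * exp (4 * L * t (n - 1)) * ?R"
      using dc4_representation_and_stability(2)[OF assms(2,3) mesh step _ _ w n] run
      by (auto simp: dc34_run_def)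
    also have "\<dots> \<le> 4 * exp (4 * L * T) * ?R"
    proof (intro mult_right_mono)
      have "t (n - 1) \<le> T"
        using mesh_mono[OF mesh, of "n - 1" N] mesh n by (auto simp: mesh_def)
      then show "4 * exp (4 * L * t (n - 1)) \<le> 4 * exp (4 * L * T)"
        using \<open>L > 0\<close> by simp
      have "0 \<le> ?E 3" "?E 3 \<le> Max (?E ` {3..n})"
        using n by (auto intro!: Max_ge)
      then have "0 \<le> Max (?E ` {3..n})"
        by (rule order_trans)
      moreover have "0 \<le> max_tau t N"
        using mesh_tau_pos[OF mesh, of 1] tau_le_max_tau[of 1 N t] n by simp
      moreover have "0 \<le> t n"
        using mesh_mono[OF mesh, of 0 n] mesh n by (simp add: mesh_def)
      ultimately show "0 \<le> ?R"
        by simp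
    qed
    finally show "\<bar>w n\<bar> \<le> 4 * exp (4 * L * T) * ?R" .
  qed
qed (intro allI impI ballI conjI dc4_representation_and_stability[OF assms(2,3)];
  auto simp: dc34_run_def)

end
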